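(* Let $K$ be a field, let $n\ge 1$, let $S=K[x_1,\dots,x_n]$ be the polynomial ring, and let $I\subset S$ be a componentwise polymatroidal monomial ideal. Then $I$ has linear quotients.
   Context: For a monomial ideal $I\subset S=K[x_1,\dots,x_n]$, $\mathcal{G}(I)$ denotes its unique minimal (finite) set of monomial generators. Linear quotients: $I$ has linear quotients if there is an ordering $u_1,\dots,u_m$ of $\mathcal{G}(I)$ such that for every $j=2,\dots,m$ the colon ideal $(u_1,\dots,u_{j-1}):u_j$ is generated by variables, i.e. by a subset of $\{x_1,\dots,x_n\}$. Discrete polymatroid: for $\mathbf{a}=(a_1,\dots,a_n)\in\mathbb{Z}_{\ge 0}^n$ put $|\mathbf{a}|=a_1+\dots+a_n$, and write $\mathbf{b}\le\mathbf{a}$ for the componentwise order; $\mathbf{e}_1,\dots,\mathbf{e}_n$ are the canonical basis vectors. A discrete polymatroid is a nonempty finite set $P\subset\mathbb{Z}_{\ge 0}^n$ such that (1) if $\mathbf{a}\in P$ and $\mathbf{b}\in\mathbb{Z}_{\ge 0}^n$ with $\mathbf{b}\le\mathbf{a}$, then $\mathbf{b}\in P$; (2) if $\mathbf{a},\mathbf{b}\in P$ with $|\mathbf{a}|<|\mathbf{b}|$, then there is an $i$ with $a_i<b_i$ and $\mathbf{a}+\mathbf{e}_i\in P$. The bases of $P$ are its maximal elements with respect to $\le$. Polymatroidal ideal: a monomial ideal $I$ is polymatroidal if the set of exponent vectors of the elements of $\mathcal{G}(I)$ is the set of bases of a discrete polymatroid. Equivalently, $I\neq 0$, all elements of $\mathcal{G}(I)$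 have the same degree, and for all $u,v\in\mathcal{G}(I)$ and all $i$ with $\deg_{x_i}(u)>\deg_{x_i}(v)$ there is $j$ with $\deg_{x_j}(u)<\deg_{x_j}(v)$ and $x_j(u/x_i)\in\mathcal{G}(I)$, where $\deg_{x_i}(u)$ is the exponent of $x_i$ in the monomial $u$. Componentwise polymatroidal ideal: for $j\ge 0$, $I_{\langle j\rangle}$ denotes the monomial ideal generated by all monomials of degree $j$ belonging to $I$. The ideal $I$ is componentwise polymatroidal if $I_{\langle j\rangle}$ is polymatroidal for all $j\ge 0$, where components with $I_{\langle j\rangle}=0$ (for example those with $j$ smaller than the least degree of a generator of $I$) are allowed. *)

theory Defs
  imports Complex_Main "HOL-Library.Poly_Mapping"
begin

text \<open>
  The ring \<open>K[x\<^sub>1, \<dots>, x\<^sub>n]\<close> is the type \<open>('n, 'k) mpoly\<close> for a field \<open>'k\<close> and an index type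
  \<open>'n\<close> of class \<open>finite\<close>, so \<open>n\<close> is the cardinality of \<open>'n\<close>, an arbitrary positive number.
  Exponent vectors have type \<open>'n \<Rightarrow>\<^sub>0 nat\<close>.
\<close>

type_synonym ('n, 'k) mpoly = "('n \<Rightarrow>\<^sub>0 nat) \<Rightarrow>\<^sub>0 'k"

text \<open>Ideals are the submodules of a commutative ring acting on itself by multiplication.\<close>

lemma module_times: "module ((*) :: 'a::comm_ring_1 \<Rightarrow> 'a \<Rightarrow> 'a)"
  by unfold_locales (simp_all add: algebra_simps)

abbreviation ideal_gen :: "'a::comm_ring_1 set \<Rightarrow> 'a set" where
  "ideal_gen \<equiv> module.span (*)"

definition colon_ideal :: "'a::comm_ring_1 set \<Rightarrow> 'a \<Rightarrow> 'a set" where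
  "colon_ideal J u = {f. f * u \<in> J}"

definition monom :: "('n \<Rightarrow>\<^sub>0 nat) \<Rightarrow> ('n, 'k::field) mpoly" where
  "monom a = Poly_Mapping.single a 1"

definition var :: "'n \<Rightarrow> ('n, 'k::field) mpoly" where
  "var i = monom (Poly_Mapping.single i 1)"

definition monomial_ideal :: "('n::finite, 'k::field) mpoly set \<Rightarrow> bool" where
  "monomial_ideal I \<longleftrightarrow> (\<exists>A. I = ideal_gen (monom ` A))"

definition is_min_monom_gens ::
  "('n::finite, 'k::field) mpoly set \<Rightarrow> ('n, 'k) mpoly set \<Rightarrow> bool" where
  "is_min_monom_gens I G \<longleftrightarrow>
     G \<subseteq> range monom \<and> ideal_gen G = I \<and> (\<forall>H. H \<subset> G \<longrightarrow> ideal_gen H \<noteq> I)"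

text \<open>For a monomial ideal the set described here exists and is unique.  It is finite by
  Dickson's lemma, so finiteness is not made part of the description.\<close>

definition min_monom_gens ::
  "('n::finite, 'k::field) mpoly set \<Rightarrow> ('n, 'k) mpoly set" where
  "min_monom_gens I = (THE G. is_min_monom_gens I G)"

text \<open>List positions start at 0, so \<open>us ! j\<close> is \<open>u\<^bsub>j+1\<^esub>\<close> and \<open>take j us\<close> is
  \<open>u\<^sub>1, \<dots>, u\<^sub>j\<close>.  The zero ideal has linear quotients, via the empty list.\<close>

definition linear_quotients :: "('n::finite, 'k::field) mpoly set \<Rightarrow> bool" where
  "linear_quotients I \<longleftrightarrow>
     (\<exists>us. distinct us \<and> set us = min_monom_gens I \<and>
        (\<forall>j. 1 \<le> j \<and> j < length us \<longrightarrow>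
           (\<exists>V. colon_ideal (ideal_gen (set (take j us))) (us ! j) = ideal_gen (var ` V))))"

definition vdeg :: "('n::finite \<Rightarrow>\<^sub>0 nat) \<Rightarrow> nat" where
  "vdeg a = (\<Sum>i\<in>UNIV. Poly_Mapping.lookup a i)"

text \<open>The componentwise order; the library's \<open>\<le>\<close> on \<open>\<Rightarrow>\<^sub>0\<close> is lexicographic.\<close>

definition vle :: "('n::finite \<Rightarrow>\<^sub>0 nat) \<Rightarrow> ('n \<Rightarrow>\<^sub>0 nat) \<Rightarrow> bool" where
  "vle b a \<longleftrightarrow> (\<forall>i. Poly_Mapping.lookup b i \<le> Poly_Mapping.lookup a i)"

definition discrete_polymatroid :: "('n::finite \<Rightarrow>\<^sub>0 nat) set \<Rightarrow> bool" where
  "discrete_polymatroid P \<longleftrightarrow>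
     P \<noteq> {} \<and> finite P \<and>
     (\<forall>a b. a \<in> P \<and> vle b a \<longrightarrow> b \<in> P) \<and>
     (\<forall>a b. a \<in> P \<and> b \<in> P \<and> vdeg a < vdeg b \<longrightarrow>
        (\<exists>i. Poly_Mapping.lookup a i < Poly_Mapping.lookup b i \<and>
             a + Poly_Mapping.single i 1 \<in> P))"

definition bases :: "('n::finite \<Rightarrow>\<^sub>0 nat) set \<Rightarrow> ('n \<Rightarrow>\<^sub>0 nat) set" where
  "bases P = {a \<in> P. \<forall>b\<in>P. vle a b \<longrightarrow> b = a}"

definition polymatroidal :: "('n::finite, 'k::field) mpoly set \<Rightarrow> bool" where
  "polymatroidal I \<longleftrightarrow>
     monomial_ideal I \<and>
     (\<exists>P. discrete_polymatroid P \<and> {a. monom a \<in> min_monom_gens I} = bases P)"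

definition ideal_component ::
  "('n::finite, 'k::field) mpoly set \<Rightarrow> nat \<Rightarrow> ('n, 'k) mpoly set" where
  "ideal_component I j = ideal_gen {monom a |a. monom a \<in> I \<and> vdeg a = j}"

text \<open>The zero ideal is not polymatroidal, as a discrete polymatroid has at least one basis;
  hence the first disjunct.\<close>

definition componentwise_polymatroidal :: "('n::finite, 'k::field) mpoly set \<Rightarrow> bool" where
  "componentwise_polymatroidal I \<longleftrightarrow>
     (\<forall>j. ideal_component I j = {0} \<or> polymatroidal (ideal_component I j))"

end

theory Submission
  imports Defs
begin

text \<open>
  The statement is a fact about exponent vectors, and it is proved by splitting off one variable
  \<open>x\<close> at a time.  Let \<open>G\<close> be the set of exponent vectors of the minimal generators of \<open>I\<close>, and let
  \<open>x\<close> be a variable that divides a generator \<open>u\<close> of \<^emph>\<open>least\<close> degree.  Write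
  \<open>I = x I\<^sub>1 + I\<^sub>2\<close>, where \<open>x I\<^sub>1\<close> is generated by the generators divisible by \<open>x\<close>, and \<open>I\<^sub>2\<close> by
  the others.

  The heart of the matter is that \<open>I\<^sub>2 \<subseteq> I\<^sub>1\<close> (lemma \<open>generator_below_shift\<close>).  Given a
  generator \<open>v\<close> without \<open>x\<close>, multiply \<open>u\<close> by a power of \<open>x\<close> to reach the degree of \<open>v\<close>.  The
  exchange property in that degree then puts \<open>x v / y\<close> into \<open>I\<close> for some variable \<open>y \<noteq> x\<close>
  dividing \<open>v\<close>.  A generator dividing \<open>x v / y\<close> must involve \<open>x\<close>, since otherwise it would
  properly divide \<open>v\<close>; removing one factor \<open>x\<close> from it leaves an element of \<open>I\<^sub>1\<close> that
  divides \<open>v\<close>.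

  There are two consequences.  First, \<open>I\<^sub>1\<close> equals the colon ideal \<open>I : x\<close>, which inherits
  the exchange property; so does \<open>I\<^sub>2\<close>, as an ideal in the variables other than \<open>x\<close>.  Second, a
  linear quotient order of \<open>x I\<^sub>1\<close> followed by one of \<open>I\<^sub>2\<close> is such an order of \<open>I\<close>: for a
  generator \<open>v\<close> of \<open>I\<^sub>2\<close> one has \<open>x I\<^sub>1 : v = x (I\<^sub>1 : v) = (x)\<close>, as \<open>v \<in> I\<^sub>1\<close>.  The sum of
  the degrees of the generators drops in passing to \<open>I\<^sub>1\<close> and to \<open>I\<^sub>2\<close>, so induction applies
  (theorem \<open>linear_quotient_order_exists\<close>).

  The exchange property used here prescribes the variable by which \<open>v\<close> grows, and not the one
  that it loses; it follows from the augmentation axiom of discrete polymatroids (lemma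
  \<open>bases_dual_exchange\<close>).  What remains is the translation between ideals and exponent vectors:
  membership in a monomial ideal is decided monomial by monomial, and Dickson's lemma makes \<open>G\<close>
  finite.
\<close>

section \<open>Exponent vectors under the componentwise order\<close>

abbreviation lookup :: "('a \<Rightarrow>\<^sub>0 'b::zero) \<Rightarrow> 'a \<Rightarrow> 'b" where
  "lookup \<equiv> Poly_Mapping.lookup"

abbreviation keys :: "('a \<Rightarrow>\<^sub>0 'b::zero) \<Rightarrow> 'a set" where
  "keys \<equiv> Poly_Mapping.keys"

abbreviation unit_vec :: "'n \<Rightarrow> ('n \<Rightarrow>\<^sub>0 nat)" where
  "unit_vec i \<equiv> Poly_Mapping.single i (Suc 0)"

lemma vle_refl [simp]: "vle a a"
  by (simp add: vle_def)

lemma vle_trans: "vle a b \<Longrightarrow> vle b c \<Longrightarrow> vle a c"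
  unfolding vle_def using order_trans by blast

lemma vle_antisym: "vle a b \<Longrightarrow> vle b a \<Longrightarrow> a = b"
  unfolding vle_def by (intro poly_mapping_eqI antisym) auto

lemma vle_add [simp]: "vle a (a + c)" "vle a (c + a)"
  by (simp_all add: vle_def lookup_add)

lemma vle_add_cancel [simp]: "vle (a + c) (b + c) \<longleftrightarrow> vle a b"
  by (simp add: vle_def lookup_add)

lemma vle_imp_add: "vle a b \<Longrightarrow> \<exists>c. b = a + c"
  by (rule exI[of _ "b - a"], rule poly_mapping_eqI) (simp add: vle_def lookup_add lookup_minus)

lemma vdeg_add [simp]: "vdeg (a + b) = vdeg a + vdeg b"
  by (simp add: vdeg_def lookup_add sum.distrib)

lemma vdeg_single [simp]: "vdeg (Poly_Mapping.single i k) = k"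
  by (simp add: vdeg_def lookup_single when_def)

lemma vdeg_eq_0_iff: "vdeg a = 0 \<longleftrightarrow> a = 0"
proof
  assume "vdeg a = 0"
  then show "a = 0" by (intro poly_mapping_eqI) (simp add: vdeg_def)
qed (simp add: vdeg_def)

lemma vdeg_mono: "vle a b \<Longrightarrow> vdeg a \<le> vdeg b"
  using vle_imp_add by fastforce

lemma vle_same_degree: "vle a b \<Longrightarrow> vdeg a = vdeg b \<Longrightarrow> a = b"
  using vle_imp_add[of a b] by (auto simp: vdeg_eq_0_iff)

lemma vle_unit_vecI: "0 < lookup a i \<Longrightarrow> vle (unit_vec i) a"
  by (auto simp: vle_def lookup_single when_def)

lemma lookup_pos_imp_add_unit_vec:
  fixes a :: "'n::finite \<Rightarrow>\<^sub>0 nat"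
  shows "0 < lookup a i \<Longrightarrow> \<exists>b. a = b + unit_vec i"
  using vle_imp_add[OF vle_unit_vecI, of a i] by (simp add: add.commute)

lemma poly_mapping_of_fun: "\<exists>c :: 'n::finite \<Rightarrow>\<^sub>0 'b::zero. \<forall>i. lookup c i = f i"
  by (rule exI[of _ "Abs_poly_mapping f"]) simp

definition multiples :: "('n::finite \<Rightarrow>\<^sub>0 nat) set \<Rightarrow> ('n \<Rightarrow>\<^sub>0 nat) set" where
  "multiples A = {b. \<exists>a\<in>A. vle a b}"

lemma multiplesI: "a \<in> A \<Longrightarrow> vle a b \<Longrightarrow> b \<in> multiples A"
  by (auto simp: multiples_def)

lemma subset_multiples: "A \<subseteq> multiples A"
  unfolding multiples_def using vle_refl by blast

lemma multiples_mono: "A \<subseteq> B \<Longrightarrow> multiples A \<subseteq> multiples B"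
  by (auto simp: multiples_def)

lemma multiples_upward: "a \<in> multiples A \<Longrightarrow> vle a b \<Longrightarrow> b \<in> multiples A"
  unfolding multiples_def using vle_trans by blast

definition vantichain :: "('n::finite \<Rightarrow>\<^sub>0 nat) set \<Rightarrow> bool" where
  "vantichain G \<longleftrightarrow> (\<forall>a\<in>G. \<forall>b\<in>G. vle a b \<longrightarrow> a = b)"

definition min_elems :: "('n::finite \<Rightarrow>\<^sub>0 nat) set \<Rightarrow> ('n \<Rightarrow>\<^sub>0 nat) set" where
  "min_elems A = {a \<in> A. \<forall>b\<in>A. vle b a \<longrightarrow> b = a}"

lemma vantichain_min_elems: "vantichain (min_elems A)"
  by (auto simp: vantichain_def min_elems_def)

lemma multiples_min_elems: "multiples (min_elems A) = multiples A"
proof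
  show "multiples (min_elems A) \<subseteq> multiples A"
    by (rule multiples_mono) (auto simp: min_elems_def)
  have "a \<in> multiples (min_elems A)" if "a \<in> A" for a
    using that
  proof (induction "vdeg a" arbitrary: a rule: less_induct)
    case less
    show ?case
    proof (cases "a \<in> min_elems A")
      case True
      then show ?thesis using subset_multiples by blast
    next
      case False
      then obtain b where b: "b \<in> A" "vle b a" "b \<noteq> a"
        using less.prems by (auto simp: min_elems_def)
      then have "vdeg b < vdeg a"
        using vdeg_mono vle_same_degree by (metis le_neq_implies_less)
      then show ?thesis using less.hyps b multiples_upward by blast
    qed
  qed
  then show "multiples A \<subseteq> multiples (min_elems A)"
    using multiples_upward by (auto simp: multiples_def[of A])
qed

lemma min_elems_subset_generators:
  assumes "multiples B = multiples A"
  shows "min_elems A \<subseteq> B"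
proof
  fix m assume m: "m \<in> min_elems A"
  then have "m \<in> multiples B" using assms subset_multiples by (auto simp: min_elems_def)
  then obtain b where b: "b \<in> B" "vle b m" by (auto simp: multiples_def)
  then have "b \<in> multiples A" using assms subset_multiples by blast
  then obtain a where a: "a \<in> A" "vle a b" by (auto simp: multiples_def)
  then have "a = m" using m b vle_trans by (auto simp: min_elems_def)
  then show "m \<in> B" using a b vle_antisym by blast
qed

lemma min_elems_homogeneous:
  assumes "\<And>a. a \<in> A \<Longrightarrow> vdeg a = d"
  shows "min_elems A = A"
  using assms vle_same_degree unfolding min_elems_def by fastforce

section \<open>Dickson's lemma\<close>

text \<open>A monotone subsequence exists in any linear order; over the natural numbers a decreasing
  one is eventually constant, so it can be replaced by a tail.\<close>

lemma nat_incseq_subseq: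
  fixes t :: "nat \<Rightarrow> nat"
  shows "\<exists>r. strict_mono r \<and> incseq (t \<circ> r)"
proof -
  obtain r where r: "strict_mono r" "monoseq (t \<circ> r)"
    using seq_monosub[of t] by (auto simp: o_def)
  show ?thesis
  proof (cases "incseq (t \<circ> r)")
    case True
    then show ?thesis using r by blast
  next
    case False
    then have dec: "decseq (t \<circ> r)" using r by (simp add: monoseq_iff)
    obtain N where N: "\<forall>n. (t \<circ> r) N \<le> (t \<circ> r) n"
      using ex_has_least_nat[of "\<lambda>_. True" 0 "t \<circ> r"] by auto
    have "(t \<circ> r) (N + m) = (t \<circ> r) N" for m
      using N dec by (intro antisym) (auto simp: decseq_def)
    then have "incseq (t \<circ> (\<lambda>m. r (N + m)))" by (simp add: incseq_def)
    moreover have "strict_mono (\<lambda>m. r (N + m))" using r(1) by (simp add: strict_mono_def)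
    ultimately show ?thesis by blast
  qed
qed

lemma coordinatewise_incseq_subseq:
  fixes s :: "nat \<Rightarrow> ('n \<Rightarrow>\<^sub>0 nat)"
  assumes "finite X"
  shows "\<exists>r. strict_mono r \<and> (\<forall>i\<in>X. incseq (\<lambda>m. lookup (s (r m)) i))"
  using assms
proof induction
  case empty
  show ?case using strict_mono_id by blast
next
  case (insert x X)
  then obtain r where r: "strict_mono r" "\<forall>i\<in>X. incseq (\<lambda>m. lookup (s (r m)) i)" by blast
  obtain q where q: "strict_mono q" "incseq ((\<lambda>m. lookup (s (r m)) x) \<circ> q)"
    using nat_incseq_subseq by blast
  have "incseq (\<lambda>m. lookup (s ((r \<circ> q) m)) i)" if "i \<in> insert x X" for i
  proof (cases "i = x")
    case True
    then show ?thesis using q by (simp add: o_def)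
  next
    case False
    then have "incseq (\<lambda>m. lookup (s (r m)) i)" using that r by blast
    then show ?thesis using q(1) by (simp add: incseq_def strict_mono_less_eq)
  qed
  then show ?case using strict_mono_o[OF r(1) q(1)] by blast
qed

theorem finite_vantichain:
  fixes G :: "('n::finite \<Rightarrow>\<^sub>0 nat) set"
  assumes "vantichain G"
  shows "finite G"
proof (rule ccontr)
  assume "infinite G"
  then obtain s :: "nat \<Rightarrow> _" where s: "inj s" "range s \<subseteq> G"
    using infinite_countable_subset by blast
  obtain r where r: "strict_mono r" "\<forall>i\<in>UNIV. incseq (\<lambda>m. lookup (s (r m)) i)"
    using coordinatewise_incseq_subseq[of UNIV s] by auto
  have "vle (s (r 0)) (s (r 1))"
    using r(2) by (simp add: vle_def incseq_def)
  then have "s (r 0) = s (r 1)" using assms s(2) unfolding vantichain_def by blast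
  then have "r 0 = r 1" using s(1) by (simp add: inj_eq)
  then show False using r(1) by (simp add: strict_mono_eq)
qed

section \<open>Exchange in every degree gives linear quotients\<close>

text \<open>
  This is the dual form of the basis exchange: the vector that is modified is \<open>v\<close>, and the
  coordinate that is prescribed is the one that grows.  The new vector \<open>v + e\<^sub>i - e\<^sub>j\<close> is
  called \<open>w\<close>, which avoids truncated subtraction.  The set \<open>X\<close> of variables is needed
  because the property depends on the ambient polynomial ring: the ideal \<open>(y, z\<^sup>2)\<close> has it in
  \<open>K[y, z]\<close>, but not in \<open>K[x, y, z]\<close>, where \<open>u = x y\<close> and \<open>v = z\<^sup>2\<close> would force \<open>x z\<close> into
  the ideal.
\<close>

definition exchange_on :: "'n set \<Rightarrow> ('n::finite \<Rightarrow>\<^sub>0 nat) set \<Rightarrow> bool" where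
  "exchange_on X U \<longleftrightarrow>
     (\<forall>u v i. u \<in> U \<and> v \<in> U \<and> keys u \<subseteq> X \<and> keys v \<subseteq> X \<and> vdeg u = vdeg v
        \<and> lookup v i < lookup u i \<longrightarrow>
        (\<exists>j w. lookup u j < lookup v j \<and> w \<in> U \<and> w + unit_vec j = v + unit_vec i))"

lemma exchange_onE:
  assumes "exchange_on X U" "u \<in> U" "v \<in> U" "keys u \<subseteq> X" "keys v \<subseteq> X" "vdeg u = vdeg v"
    "lookup v i < lookup u i"
  obtains j w where "lookup u j < lookup v j" "w \<in> U" "w + unit_vec j = v + unit_vec i"
  using assms unfolding exchange_on_def by blast

text \<open>
  The condition on a list of exponent vectors that its monomials have linear quotients in the
  given order: whenever \<open>u\<close> precedes \<open>v\<close>, the colon ideal of the predecessors of \<open>v\<close> contains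
  a variable that divides \<open>u : v\<close>.
\<close>

definition linear_quotient_order :: "('n::finite \<Rightarrow>\<^sub>0 nat) list \<Rightarrow> bool" where
  "linear_quotient_order gs \<longleftrightarrow>
     (\<forall>xs v ys. gs = xs @ v # ys \<longrightarrow>
        (\<forall>u\<in>set xs. \<exists>i. lookup v i < lookup u i \<and> (\<exists>w\<in>set xs. vle w (v + unit_vec i))))"

text \<open>
  Multiplying \<open>hs\<close> by \<open>x\<close> does not change the colon ideals among its members.  The two hypotheses
  on the members \<open>v\<close> of \<open>ks\<close> make \<open>x hs : v\<close> the ideal generated by \<open>x\<close>.
\<close>

lemma linear_quotient_order_append:
  assumes hs: "linear_quotient_order hs" and ks: "linear_quotient_order ks"
    and free: "\<And>v. v \<in> set ks \<Longrightarrow> lookup v x = 0"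
    and below: "\<And>v. v \<in> set ks \<Longrightarrow> v \<in> multiples (set hs)"
  shows "linear_quotient_order (map (\<lambda>h. h + unit_vec x) hs @ ks)"
  unfolding linear_quotient_order_def
proof (intro allI impI ballI)
  let ?f = "\<lambda>h. h + unit_vec x"
  fix xs v ys u
  assume eq: "map ?f hs @ ks = xs @ v # ys" and u: "u \<in> set xs"
  have "(\<exists>zs. map ?f hs = xs @ v # zs) \<or> (\<exists>zs. xs = map ?f hs @ zs \<and> ks = zs @ v # ys)"
    using eq unfolding append_eq_append_conv2 by (auto simp: append_eq_Cons_conv)
  then consider zs where "map ?f hs = xs @ v # zs"
    | zs where "xs = map ?f hs @ zs" "ks = zs @ v # ys"
    by blast
  then show "\<exists>i. lookup v i < lookup u i \<and> (\<exists>w\<in>set xs. vle w (v + unit_vec i))"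
  proof cases
    case 1
    then obtain xs' v' zs' where hs_eq: "hs = xs' @ v' # zs'"
      and xs: "xs = map ?f xs'" and v: "v = ?f v'"
      by (auto simp: map_eq_append_conv map_eq_Cons_conv)
    from u xs obtain u' where u': "u' \<in> set xs'" "u = ?f u'" by auto
    then obtain i w' where i: "lookup v' i < lookup u' i" "w' \<in> set xs'" "vle w' (v' + unit_vec i)"
      using hs hs_eq unfolding linear_quotient_order_def by blast
    have "lookup v i < lookup u i" using i(1) by (simp add: u' v lookup_add)
    moreover have "?f w' \<in> set xs" using i(2) xs by simp
    moreover have "vle (?f w') (v + unit_vec i)"
      using i(3) vle_add_cancel[of w' "unit_vec x" "v' + unit_vec i"] by (simp add: v ac_simps)
    ultimately show ?thesis by blast
  next
    case 2
    show ?thesis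
    proof (cases "u \<in> set zs")
      case True
      then show ?thesis using ks 2 unfolding linear_quotient_order_def by fastforce
    next
      case False
      then have "0 < lookup u x" using u 2 by (auto simp: lookup_add)
      moreover have "lookup v x = 0" using free 2 by simp
      moreover obtain h where "h \<in> set hs" "vle h v"
        using below[of v] 2 by (auto simp: multiples_def)
      then have "?f h \<in> set xs" "vle (?f h) (v + unit_vec x)" using 2 by simp_all
      ultimately show ?thesis by (metis)
    qed
  qed
qed

text \<open>
  The inclusion \<open>I\<^sub>2 \<subseteq> I\<^sub>1\<close>.  Minimality of the degree of \<open>u\<close> makes it possible to lift \<open>u\<close>
  to the degree of \<open>v\<close>, where the two can be compared.  Lifting by a power of \<open>x\<close> keeps the
  support inside \<open>X\<close>.
\<close>

lemma generator_below_shift: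
  assumes G: "vantichain G" "\<And>g. g \<in> G \<Longrightarrow> keys g \<subseteq> X"
    and ex: "exchange_on X (multiples G)"
    and u: "u \<in> G" "\<And>g. g \<in> G \<Longrightarrow> vdeg u \<le> vdeg g" "0 < lookup u x"
    and v: "v \<in> G" "lookup v x = 0"
  shows "\<exists>h. h + unit_vec x \<in> G \<and> vle h v"
proof -
  define u' where "u' = u + Poly_Mapping.single x (vdeg v - vdeg u)"
  have deg: "vdeg u' = vdeg v" using u(2)[OF v(1)] by (simp add: u'_def)
  have "x \<in> X" using u(3) G(2)[OF u(1)] by (auto simp: in_keys_iff)
  then have keys_u': "keys u' \<subseteq> X"
    using G(2)[OF u(1)] keys_add[of u "Poly_Mapping.single x (vdeg v - vdeg u)"]
    by (auto simp: u'_def split: if_splits)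
  have "u' \<in> multiples G" "v \<in> multiples G"
    using u(1) v(1) by (auto simp: u'_def intro: multiplesI)
  moreover have "lookup v x < lookup u' x"
    using u(3) v(2) by (simp add: u'_def lookup_add)
  ultimately obtain j w where j: "lookup u' j < lookup v j" and w: "w \<in> multiples G"
    and wj: "w + unit_vec j = v + unit_vec x"
    using exchange_onE[OF ex _ _ keys_u' _ deg] G(2)[OF v(1)] by blast
  obtain g where g: "g \<in> G" "vle g w" using w by (auto simp: multiples_def)
  have "j \<noteq> x" using j v(2) by auto
  \<comment> \<open>Without \<open>x\<close>, the generator \<open>g\<close> would divide \<open>v\<close> with the factor \<open>j\<close> removed.\<close>
  have "0 < lookup g x"
  proof (rule ccontr)
    assume gx: "\<not> 0 < lookup g x"
    have wi: "lookup w i + lookup (unit_vec j) i = lookup v i + lookup (unit_vec x) i" for i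
      using arg_cong[OF wj, of "\<lambda>a. lookup a i"] by (simp add: lookup_add)
    have "lookup g i \<le> lookup v i" for i
    proof (cases "i = x")
      case False
      then have "lookup w i \<le> lookup v i" using wi[of i] by (simp add: lookup_single)
      then show ?thesis using g(2) order_trans unfolding vle_def by blast
    qed (use gx in simp)
    then have "g = v" using G(1) g(1) v(1) by (simp add: vantichain_def vle_def)
    then have "lookup v j \<le> lookup w j" using g(2) by (simp add: vle_def)
    then show False using wi[of j] \<open>j \<noteq> x\<close> by (simp add: lookup_single)
  qed
  then obtain h where h: "g = h + unit_vec x"
    using lookup_pos_imp_add_unit_vec[of g x] by blast
  have "vle g (v + unit_vec x)"
    using vle_trans[OF g(2) vle_add(1)[of w "unit_vec j"]] by (simp only: wj)
  then have "vle h v" by (simp add: h)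
  then show ?thesis using g(1) h by auto
qed

text \<open>
  The sets \<open>G1\<close> and \<open>G2\<close> generate \<open>I\<^sub>1\<close> and \<open>I\<^sub>2\<close>; the sum of the degrees drops for \<open>G1\<close> because
  a factor \<open>x\<close> is removed, and for \<open>G2\<close> because \<open>u\<close> is dropped.  The exchange property passes to
  \<open>I\<^sub>1\<close> because \<open>I\<^sub>1 = I : x\<close>, and to \<open>I\<^sub>2\<close> because an exchange between vectors that vanish at
  \<open>x\<close> yields such a vector.
\<close>

theorem linear_quotient_order_exists:
  assumes "finite G" "vantichain G" "\<And>g. g \<in> G \<Longrightarrow> keys g \<subseteq> X" "exchange_on X (multiples G)"
  shows "\<exists>gs. distinct gs \<and> set gs = G \<and> linear_quotient_order gs"
  using assms
proof (induction "\<Sum>g\<in>G. vdeg g" arbitrary: G X rule: less_induct)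
  case less
  note fin = less.prems(1) and anti = less.prems(2) and supp = less.prems(3)
    and ex = less.prems(4)
  consider "G = {}" | "0 \<in> G" | "G \<noteq> {}" "0 \<notin> G" by blast
  then show ?case
  proof cases
    case 1
    have "linear_quotient_order []" by (simp add: linear_quotient_order_def)
    then show ?thesis using 1 by (intro exI[of _ "[]"]) simp
  next
    case 2
    then have "G = {0}" using anti by (auto simp: vantichain_def vle_def)
    moreover have "linear_quotient_order [0]"
      by (auto simp: linear_quotient_order_def Cons_eq_append_conv)
    ultimately show ?thesis by (intro exI[of _ "[0]"]) simp
  next
    case 3
    then obtain u where u: "u \<in> G" "\<And>g. g \<in> G \<Longrightarrow> vdeg u \<le> vdeg g"
      using ex_has_least_nat[of "\<lambda>g. g \<in> G" _ vdeg] by blast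
    then have "u \<noteq> 0" using 3 by blast
    then obtain x where x: "0 < lookup u x"
      by (metis gr0I lookup_zero poly_mapping_eqI)
    let ?f = "\<lambda>h. h + unit_vec x"
    define G1 where "G1 = {h. ?f h \<in> G}"
    define G2 where "G2 = {g \<in> G. lookup g x = 0}"
    have "g \<in> ?f ` G1 \<union> G2" if "g \<in> G" for g
      using that lookup_pos_imp_add_unit_vec[of g x] by (auto simp: G1_def G2_def)
    then have G_eq: "G = ?f ` G1 \<union> G2" by (auto simp: G1_def G2_def)
    have inj: "inj_on ?f G1" by (auto intro: inj_onI)
    have fin1: "finite G1" using fin G_eq inj finite_imageD by blast
    have fin2: "finite G2" using fin by (simp add: G2_def)
    have sub1: "?f ` G1 \<subseteq> G" by (auto simp: G1_def)
    have "u \<notin> G2" using x by (simp add: G2_def)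
    then have "G1 \<noteq> {}" using G_eq u(1) by blast
    have below: "v \<in> multiples G1" if "v \<in> G2" for v
      using generator_below_shift[OF anti supp ex u x] that
      by (auto simp: G1_def G2_def multiples_def)
    have colon: "a \<in> multiples G1" if a: "?f a \<in> multiples G" for a
    proof -
      obtain g where g: "g \<in> G" "vle g (?f a)" using a by (auto simp: multiples_def)
      show ?thesis
      proof (cases "g \<in> G2")
        case True
        have "lookup g i \<le> lookup a i" for i
          using g(2)[unfolded vle_def, rule_format, of i] True
          by (cases "i = x") (simp_all add: G2_def lookup_add lookup_single)
        then have "vle g a" by (simp add: vle_def)
        then show ?thesis using below[OF True] multiples_upward by blast
      next
        case False
        then obtain h where "h \<in> G1" "g = ?f h" using g(1) G_eq by blast
        then show ?thesis using g(2) by (auto intro: multiplesI)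
      qed
    qed
    have shift: "?f a \<in> multiples G" if "a \<in> multiples G1" for a
      using that by (auto simp: multiples_def G1_def intro!: bexI)
    have x_in_X: "x \<in> X" using x supp[OF u(1)] by (auto simp: in_keys_iff)
    have keys_f: "keys (?f a) \<subseteq> X" if "keys a \<subseteq> X" for a
      using that x_in_X keys_add[of a "unit_vec x"] by auto
    have "\<exists>hs. distinct hs \<and> set hs = G1 \<and> linear_quotient_order hs"
    proof (rule less.hyps)
      have "(\<Sum>h\<in>G1. vdeg h) < (\<Sum>h\<in>G1. vdeg (?f h))"
        using fin1 \<open>G1 \<noteq> {}\<close> by (intro sum_strict_mono) auto
      also have "\<dots> = (\<Sum>g\<in>?f ` G1. vdeg g)" using inj by (simp add: sum.reindex)
      also have "\<dots> \<le> (\<Sum>g\<in>G. vdeg g)" using fin sub1 by (intro sum_mono2) auto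
      finally show "(\<Sum>h\<in>G1. vdeg h) < (\<Sum>g\<in>G. vdeg g)" .
      show "finite G1" by fact
      show "vantichain G1" using anti by (fastforce simp: vantichain_def G1_def)
      show "keys h \<subseteq> X" if "h \<in> G1" for h
        using supp[of "?f h"] that by (auto simp: G1_def in_keys_iff lookup_add)
      show "exchange_on X (multiples G1)"
        unfolding exchange_on_def
      proof (intro allI impI, elim conjE)
        fix a b i
        assume ab: "a \<in> multiples G1" "b \<in> multiples G1" "keys a \<subseteq> X" "keys b \<subseteq> X"
          "vdeg a = vdeg b" "lookup b i < lookup a i"
        obtain j w where j: "lookup (?f a) j < lookup (?f b) j" and w: "w \<in> multiples G"
          and wj: "w + unit_vec j = ?f b + unit_vec i"
          using exchange_onE[OF ex shift[OF ab(1)] shift[OF ab(2)] keys_f[OF ab(3)]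
              keys_f[OF ab(4)], of i] ab(5,6) by (auto simp: lookup_add)
        have j': "lookup a j < lookup b j" using j by (simp add: lookup_add)
        have "lookup w x + lookup (unit_vec j) x = lookup b x + 1 + lookup (unit_vec i) x"
          using arg_cong[OF wj, of "\<lambda>c. lookup c x"] by (simp add: lookup_add)
        then have "0 < lookup w x"
          using j' by (cases "j = x") (auto simp: lookup_single)
        then obtain w' where w': "w = ?f w'"
          using lookup_pos_imp_add_unit_vec[of w x] by blast
        have "(w' + unit_vec j) + unit_vec x = (b + unit_vec i) + unit_vec x"
          using wj w' by (simp add: ac_simps)
        then have "w' + unit_vec j = b + unit_vec i" by simp
        then show "\<exists>j w. lookup a j < lookup b j \<and> w \<in> multiples G1
            \<and> w + unit_vec j = b + unit_vec i"
          using j' colon w w' by blast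
      qed
    qed
    then obtain hs where hs: "distinct hs" "set hs = G1" "linear_quotient_order hs" by blast
    have "\<exists>ks. distinct ks \<and> set ks = G2 \<and> linear_quotient_order ks"
    proof (rule less.hyps)
      show "(\<Sum>g\<in>G2. vdeg g) < (\<Sum>g\<in>G. vdeg g)"
      proof (rule sum_strict_mono2[OF fin _ u(1)[THEN DiffI, OF \<open>u \<notin> G2\<close>]])
        show "G2 \<subseteq> G" by (auto simp: G2_def)
        show "0 < vdeg u" using \<open>u \<noteq> 0\<close> vdeg_eq_0_iff[of u] by simp
      qed simp
      show "finite G2" by fact
      show "vantichain G2" using anti by (auto simp: vantichain_def G2_def)
      show "keys g \<subseteq> X - {x}" if "g \<in> G2" for g
        using supp[of g] that by (auto simp: G2_def in_keys_iff)
      show "exchange_on (X - {x}) (multiples G2)"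
        unfolding exchange_on_def
      proof (intro allI impI, elim conjE)
        fix a b i
        assume ab: "a \<in> multiples G2" "b \<in> multiples G2" "keys a \<subseteq> X - {x}"
          "keys b \<subseteq> X - {x}" "vdeg a = vdeg b" "lookup b i < lookup a i"
        have sub: "multiples G2 \<subseteq> multiples G" by (rule multiples_mono) (auto simp: G2_def)
        obtain j w where j: "lookup a j < lookup b j" and w: "w \<in> multiples G"
          and wj: "w + unit_vec j = b + unit_vec i"
          using exchange_onE[OF ex _ _ _ _ ab(5,6)] ab(1-4) sub by blast
        \<comment> \<open>The vector \<open>w\<close> still avoids \<open>x\<close>, hence so does every generator below it.\<close>
        have "lookup a x = 0" "lookup b x = 0" using ab(3,4) by (auto simp: in_keys_iff)
        then have "i \<noteq> x" using ab(6) by auto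
        have "lookup w x = 0"
          using arg_cong[OF wj, of "\<lambda>c. lookup c x"] \<open>i \<noteq> x\<close>
          \<open>lookup b x = 0\<close>
          by (simp add: lookup_add lookup_single)
        moreover obtain g where g: "g \<in> G" "vle g w" using w by (auto simp: multiples_def)
        ultimately have "g \<in> G2"
          unfolding G2_def vle_def by (metis (mono_tags) le_zero_eq mem_Collect_eq)
        then have "w \<in> multiples G2" using g(2) by (rule multiplesI)
        then show "\<exists>j w. lookup a j < lookup b j \<and> w \<in> multiples G2
            \<and> w + unit_vec j = b + unit_vec i"
          using j wj by blast
      qed
    qed
    then obtain ks where ks: "distinct ks" "set ks = G2" "linear_quotient_order ks" by blast
    have "linear_quotient_order (map ?f hs @ ks)"
      using hs ks below by (intro linear_quotient_order_append) (auto simp: G2_def)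
    moreover have "distinct (map ?f hs @ ks)"
      using hs ks inj by (auto simp: distinct_map G2_def lookup_add)
    moreover have "set (map ?f hs @ ks) = G" using hs ks G_eq by simp
    ultimately show ?thesis by blast
  qed
qed

section \<open>Monomial ideals\<close>

lemma inj_monom: "inj (monom :: ('n \<Rightarrow>\<^sub>0 nat) \<Rightarrow> ('n, 'k::field) mpoly)"
proof (rule injI)
  fix a b :: "'n \<Rightarrow>\<^sub>0 nat"
  assume "(monom a :: ('n, 'k) mpoly) = monom b"
  then have "keys (monom a :: ('n, 'k) mpoly) = keys (monom b :: ('n, 'k) mpoly)" by simp
  then show "a = b" by (simp add: monom_def)
qed

lemma keys_monom [simp]: "keys (monom a :: ('n, 'k::field) mpoly) = {a}"
  by (simp add: monom_def)

lemma poly_mapping_eq_sum_single: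
  fixes f :: "'a \<Rightarrow>\<^sub>0 'b::comm_monoid_add"
  shows "f = (\<Sum>a\<in>keys f. Poly_Mapping.single a (lookup f a))"
  by (rule poly_mapping_eqI)
    (auto simp: lookup_sum lookup_single when_def in_keys_iff cong: sum.cong)

text \<open>Membership in a monomial ideal is decided monomial by monomial.\<close>

lemma mem_ideal_gen_monom:
  fixes f :: "('n::finite, 'k::field) mpoly"
  shows "f \<in> ideal_gen (monom ` A) \<longleftrightarrow> keys f \<subseteq> multiples A"
proof
  assume "f \<in> ideal_gen (monom ` A)"
  also have "ideal_gen (monom ` A) \<subseteq> {g :: ('n, 'k) mpoly. keys g \<subseteq> multiples A}"
  proof (rule module.span_minimal[OF module_times])
    show "monom ` A \<subseteq> {g :: ('n, 'k) mpoly. keys g \<subseteq> multiples A}"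
      using subset_multiples[of A] by auto
    show "module.subspace (*) {g :: ('n, 'k) mpoly. keys g \<subseteq> multiples A}"
    proof (rule module.subspaceI[OF module_times])
      show "g + h \<in> {g :: ('n, 'k) mpoly. keys g \<subseteq> multiples A}"
        if "g \<in> {g. keys g \<subseteq> multiples A}" "h \<in> {g. keys g \<subseteq> multiples A}" for g h
        using that keys_add[of g h] by blast
      show "c * g \<in> {g :: ('n, 'k) mpoly. keys g \<subseteq> multiples A}"
        if "g \<in> {g. keys g \<subseteq> multiples A}" for c g
        using that keys_mult[of c g] multiples_upward vle_add(2) by blast
    qed simp
  qed
  finally show "keys f \<subseteq> multiples A" by simp
next
  assume f: "keys f \<subseteq> multiples A"
  have "Poly_Mapping.single b c \<in> ideal_gen (monom ` A :: ('n, 'k) mpoly set)"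
    if "b \<in> multiples A" for b c
  proof -
    obtain a where a: "a \<in> A" "vle a b" using \<open>b \<in> multiples A\<close> by (auto simp: multiples_def)
    then obtain d where "b = a + d" using vle_imp_add by blast
    then have "Poly_Mapping.single b c = Poly_Mapping.single d c * (monom a :: ('n, 'k) mpoly)"
      by (simp add: monom_def mult_single add.commute)
    then show ?thesis
      using a(1) by (simp add: module.span_scale[OF module_times] module.span_base[OF module_times])
  qed
  then have "(\<Sum>a\<in>keys f. Poly_Mapping.single a (lookup f a)) \<in> ideal_gen (monom ` A)"
    using f by (intro module.span_sum[OF module_times]) blast
  then show "f \<in> ideal_gen (monom ` A)" using poly_mapping_eq_sum_single[of f] by simp
qed

lemma monom_mem_ideal_gen:
  "(monom a :: ('n::finite, 'k::field) mpoly) \<in> ideal_gen (monom ` A) \<longleftrightarrow> a \<in> multiples A"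
  by (simp add: mem_ideal_gen_monom)

lemma ideal_gen_monom_eq_iff:
  "ideal_gen (monom ` A :: ('n::finite, 'k::field) mpoly set) = ideal_gen (monom ` B)
     \<longleftrightarrow> multiples A = multiples B"
proof
  assume "ideal_gen (monom ` A :: ('n, 'k) mpoly set) = ideal_gen (monom ` B)"
  then show "multiples A = multiples B"
    by (metis monom_mem_ideal_gen subsetI subset_antisym)
next
  assume "multiples A = multiples B"
  then show "ideal_gen (monom ` A :: ('n, 'k) mpoly set) = ideal_gen (monom ` B)"
    using mem_ideal_gen_monom by blast
qed

text \<open>The minimal elements of \<open>A\<close> lie in every generating set of the same ideal and generate it
  themselves.\<close>

lemma is_min_monom_gens_iff:
  fixes G :: "('n::finite, 'k::field) mpoly set"
  shows "is_min_monom_gens (ideal_gen (monom ` A)) G \<longleftrightarrow> G = monom ` min_elems A"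
proof
  assume G: "is_min_monom_gens (ideal_gen (monom ` A)) G"
  then obtain B where B: "G = monom ` B"
    unfolding is_min_monom_gens_def by (metis subset_image_iff)
  have "ideal_gen G = ideal_gen (monom ` A)" using G by (simp add: is_min_monom_gens_def)
  then have "multiples B = multiples A" by (simp add: B ideal_gen_monom_eq_iff)
  then have "min_elems A \<subseteq> B" by (rule min_elems_subset_generators)
  then have "monom ` min_elems A \<subseteq> G" using B by blast
  moreover have "ideal_gen (monom ` min_elems A :: ('n, 'k) mpoly set) = ideal_gen (monom ` A)"
    by (simp add: ideal_gen_monom_eq_iff multiples_min_elems)
  ultimately show "G = monom ` min_elems A"
    using G unfolding is_min_monom_gens_def by (metis psubsetI)
next
  assume G: "G = monom ` min_elems A"
  show "is_min_monom_gens (ideal_gen (monom ` A)) G"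
    unfolding is_min_monom_gens_def
  proof (intro conjI allI impI)
    show "G \<subseteq> range monom" using G by blast
    show "ideal_gen G = ideal_gen (monom ` A)"
      by (simp add: G ideal_gen_monom_eq_iff multiples_min_elems)
    fix H assume H: "H \<subset> G"
    then obtain B where B: "H = monom ` B" "B \<subseteq> min_elems A"
      unfolding G by (metis psubset_imp_subset subset_image_iff)
    show "ideal_gen H \<noteq> ideal_gen (monom ` A)"
    proof
      assume "ideal_gen H = ideal_gen (monom ` A)"
      then have "min_elems A \<subseteq> B"
        using B(1) ideal_gen_monom_eq_iff min_elems_subset_generators by blast
      then show False using H B G by blast
    qed
  qed
qed

lemma min_monom_gens_ideal_gen:
  "min_monom_gens (ideal_gen (monom ` A) :: ('n::finite, 'k::field) mpoly set)
     = monom ` min_elems A"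
  unfolding min_monom_gens_def is_min_monom_gens_iff by (rule the_equality) simp_all

lemma keys_mult_monom:
  fixes f :: "('n::finite, 'k::field) mpoly"
  assumes "a \<in> keys f"
  shows "a + v \<in> keys (f * monom v)"
proof -
  have "f * monom v = (\<Sum>b\<in>keys f. Poly_Mapping.single b (lookup f b)) * monom v"
    using poly_mapping_eq_sum_single[of f] by simp
  also have "\<dots> = (\<Sum>b\<in>keys f. Poly_Mapping.single (b + v) (lookup f b))"
    by (simp add: sum_distrib_right monom_def mult_single)
  finally have "lookup (f * monom v) (a + v) = (\<Sum>b\<in>keys f. lookup f b when b = a)"
    by (simp add: lookup_sum lookup_single)
  also have "\<dots> = lookup f a" using assms by (simp add: when_def sum.delta')
  finally show ?thesis using assms by (simp add: in_keys_iff)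
qed

text \<open>If \<open>f\<close> is a monomial and \<open>f v\<close> a multiple of \<open>u\<close>, then \<open>f\<close> is divisible by every variable
  whose exponent in \<open>u\<close> exceeds that in \<open>v\<close>; by assumption one of these lies in the colon ideal.\<close>

lemma colon_ideal_generated_by_vars:
  fixes v :: "'n::finite \<Rightarrow>\<^sub>0 nat"
  assumes "\<And>u. u \<in> A \<Longrightarrow> \<exists>i. lookup v i < lookup u i \<and> (\<exists>w\<in>A. vle w (v + unit_vec i))"
  defines "V \<equiv> {i. v + unit_vec i \<in> multiples A}"
  shows "colon_ideal (ideal_gen (monom ` A)) (monom v :: ('n, 'k::field) mpoly)
     = ideal_gen (var ` V)"
proof
  have var_V: "(var ` V :: ('n, 'k) mpoly set) = monom ` unit_vec ` V"
    by (auto simp: var_def)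
  show "colon_ideal (ideal_gen (monom ` A)) (monom v) \<subseteq> ideal_gen (var ` V :: ('n, 'k) mpoly set)"
  proof
    fix f :: "('n, 'k) mpoly"
    assume "f \<in> colon_ideal (ideal_gen (monom ` A)) (monom v)"
    then have f: "keys (f * monom v) \<subseteq> multiples A"
      by (simp add: colon_ideal_def mem_ideal_gen_monom)
    have "a \<in> multiples (unit_vec ` V)" if a: "a \<in> keys f" for a
    proof -
      obtain u where u: "u \<in> A" "vle u (a + v)"
        using f keys_mult_monom[OF a] by (auto simp: multiples_def)
      then obtain i where i: "lookup v i < lookup u i" "\<exists>w\<in>A. vle w (v + unit_vec i)"
        using assms(1) by blast
      then have "i \<in> V" by (auto simp: V_def multiples_def)
      moreover have "lookup u i \<le> lookup a i + lookup v i"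
        using u(2) by (simp add: vle_def lookup_add)
      then have "vle (unit_vec i) a" using i(1) by (intro vle_unit_vecI) simp
      ultimately show ?thesis by (auto intro: multiplesI)
    qed
    then show "f \<in> ideal_gen (var ` V)" unfolding var_V mem_ideal_gen_monom by blast
  qed
  show "ideal_gen (var ` V :: ('n, 'k) mpoly set) \<subseteq> colon_ideal (ideal_gen (monom ` A)) (monom v)"
  proof
    fix f :: "('n, 'k) mpoly"
    assume "f \<in> ideal_gen (var ` V)"
    then have f: "keys f \<subseteq> multiples (unit_vec ` V)" by (simp add: var_V mem_ideal_gen_monom)
    have "a + v \<in> multiples A" if "a \<in> keys f" for a
    proof -
      obtain i where i: "i \<in> V" "vle (unit_vec i) a"
        using f \<open>a \<in> keys f\<close> by (auto simp: multiples_def)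
      then have "vle (unit_vec i + v) (a + v)" by simp
      then show ?thesis
        using i(1) multiples_upward by (auto simp: V_def add.commute)
    qed
    then have "keys (f * monom v) \<subseteq> multiples A"
      using keys_mult[of f "monom v"] by auto
    then show "f \<in> colon_ideal (ideal_gen (monom ` A)) (monom v)"
      by (simp add: colon_ideal_def mem_ideal_gen_monom)
  qed
qed

lemma linear_quotients_if_order:
  assumes gs: "distinct gs" "set gs = min_elems A" "linear_quotient_order gs"
  shows "linear_quotients (ideal_gen (monom ` A) :: ('n::finite, 'k::field) mpoly set)"
  unfolding linear_quotients_def
proof (intro exI[of _ "map monom gs"] conjI allI impI)
  show "distinct (map monom gs :: ('n, 'k) mpoly list)"
    using gs(1) inj_monom by (auto simp: distinct_map intro: inj_on_subset)
  show "set (map monom gs) = min_monom_gens (ideal_gen (monom ` A) :: ('n, 'k) mpoly set)"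
    using gs(2) by (simp add: min_monom_gens_ideal_gen)
  fix j assume "1 \<le> j \<and> j < length (map monom gs :: ('n, 'k) mpoly list)"
  then have j: "j < length gs" by simp
  have "gs = take j gs @ gs ! j # drop (Suc j) gs" using j by (rule id_take_nth_drop)
  then have "\<exists>i. lookup (gs ! j) i < lookup u i
      \<and> (\<exists>w\<in>set (take j gs). vle w (gs ! j + unit_vec i))" if "u \<in> set (take j gs)" for u
    using gs(3) that unfolding linear_quotient_order_def by blast
  from colon_ideal_generated_by_vars[OF this]
  show "\<exists>V. colon_ideal (ideal_gen (set (take j (map monom gs)))) (map monom gs ! j)
      = (ideal_gen (var ` V) :: ('n, 'k) mpoly set)"
    using j by (auto simp: take_map)
qed

section \<open>Polymatroidal ideals have the exchange property\<close>

lemma discrete_polymatroid_augment_to_degree: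
  assumes P: "discrete_polymatroid P" and "c \<in> P" "v \<in> P" "vdeg c \<le> vdeg v"
  shows "\<exists>w\<in>P. vle c w \<and> vdeg w = vdeg v \<and> (\<forall>i. lookup w i \<le> max (lookup c i) (lookup v i))"
  using assms(2,4)
proof (induction "vdeg v - vdeg c" arbitrary: c)
  case 0
  then show ?case by (intro bexI[of _ c]) auto
next
  case (Suc n)
  then have "vdeg c < vdeg v" by simp
  then obtain i where i: "lookup c i < lookup v i" "c + unit_vec i \<in> P"
    using P Suc.prems(1) assms(3) unfolding discrete_polymatroid_def One_nat_def by meson
  moreover have "n = vdeg v - vdeg (c + unit_vec i)" "vdeg (c + unit_vec i) \<le> vdeg v"
    using Suc.hyps(2) by simp_all
  ultimately obtain w where w: "w \<in> P" "vle (c + unit_vec i) w" "vdeg w = vdeg v"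
    "\<And>k. lookup w k \<le> max (lookup (c + unit_vec i) k) (lookup v k)"
    using Suc.hyps(1)[of "c + unit_vec i"] by blast
  have "lookup w k \<le> max (lookup c k) (lookup v k)" for k
    using w(4)[of k] i(1) by (cases "k = i") (auto simp: lookup_add lookup_single)
  moreover have "vle c w" using w(2) vle_trans vle_add(1) by blast
  ultimately show ?case using w by blast
qed

lemma mem_bases_if_degree_of_basis:
  assumes P: "discrete_polymatroid P" and v: "v \<in> bases P" and w: "w \<in> P" "vdeg w = vdeg v"
  shows "w \<in> bases P"
proof -
  have "b = w" if b: "b \<in> P" "vle w b" for b
  proof (rule ccontr)
    assume "b \<noteq> w"
    then have "vdeg v < vdeg b"
      using b(2) w(2) vdeg_mono vle_same_degree by (metis le_neq_implies_less)
    then obtain i where "v + unit_vec i \<in> P"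
      using P v b(1) unfolding discrete_polymatroid_def bases_def One_nat_def by blast
    then have "v + unit_vec i = v" using v vle_add(1) by (auto simp: bases_def)
    then have "vdeg (v + unit_vec i) = vdeg v" by (rule arg_cong)
    then show False by simp
  qed
  then show ?thesis using w(1) by (simp add: bases_def)
qed

text \<open>
  The dual exchange comes from augmenting \<open>c = min (v + e\<^sub>i) u\<close>, which lies below \<open>u\<close>, by
  coordinates of \<open>v\<close>.  The result stays below \<open>v + e\<^sub>i\<close> and has degree one less, so it misses one
  \<open>e\<^sub>j\<close>.  As it lies above \<open>c\<close>, this \<open>j\<close> satisfies \<open>u\<^sub>j < v\<^sub>j\<close>.
\<close>

lemma bases_dual_exchange:
  assumes P: "discrete_polymatroid P" and u: "u \<in> bases P" and v: "v \<in> bases P"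
    and deg: "vdeg u = vdeg v" and i: "lookup v i < lookup u i"
  shows "\<exists>j w. lookup u j < lookup v j \<and> w \<in> bases P \<and> w + unit_vec j = v + unit_vec i"
proof -
  let ?v = "v + unit_vec i"
  obtain c where c: "\<And>k. lookup c k = min (lookup ?v k) (lookup u k)"
    using poly_mapping_of_fun[of "\<lambda>k. min (lookup ?v k) (lookup u k)"] by blast
  have c_le_u: "vle c u" by (simp add: vle_def c)
  then have "c \<in> P" using P u unfolding discrete_polymatroid_def bases_def by blast
  moreover have "vdeg c \<le> vdeg v" using vdeg_mono[OF c_le_u] deg by simp
  moreover have "v \<in> P" using v by (simp add: bases_def)
  ultimately obtain w where w: "w \<in> P" "vle c w" "vdeg w = vdeg v"
    "\<And>k. lookup w k \<le> max (lookup c k) (lookup v k)"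
    using discrete_polymatroid_augment_to_degree[OF P] by blast
  have "lookup w k \<le> lookup ?v k" for k
    using w(4)[of k] by (simp add: c lookup_add)
  then have "vle w ?v" by (simp add: vle_def)
  then obtain d where d: "?v = w + d" using vle_imp_add by blast
  have "vdeg ?v = vdeg w + vdeg d" by (simp add: d)
  then have "vdeg d = 1" using w(3) by simp
  then have "d \<noteq> 0" by (auto simp: vdeg_def)
  then obtain j where "0 < lookup d j" by (metis gr0I lookup_zero poly_mapping_eqI)
  then have "vle (unit_vec j) d" by (rule vle_unit_vecI)
  then have "d = unit_vec j" using vle_same_degree \<open>vdeg d = 1\<close> by fastforce
  then have wj: "w + unit_vec j = ?v" using d by simp
  have wk: "lookup w k + lookup (unit_vec j) k = lookup v k + lookup (unit_vec i) k" for k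
    using arg_cong[OF wj, of "\<lambda>a. lookup a k"] by (simp add: lookup_add)
  have ck: "lookup c k \<le> lookup w k" for k using w(2) by (simp add: vle_def)
  \<comment> \<open>The coordinate at \<open>i\<close> was raised already in \<open>c\<close>, because \<open>u\<close> exceeds \<open>v\<close> there.\<close>
  have "j \<noteq> i" using wk[of i] ck[of i] i by (auto simp: c lookup_add)
  then have "lookup u j < lookup v j"
    using wk[of j] ck[of j] by (auto simp: c lookup_add lookup_single min_def split: if_splits)
  moreover have "w \<in> bases P" using mem_bases_if_degree_of_basis[OF P v w(1,3)] .
  ultimately show ?thesis using wj by blast
qed

text \<open>Distinct monomials of equal degree do not divide each other, so the minimal generators of
  the component in degree \<open>d\<close> are \<^emph>\<open>all\<close> monomials of degree \<open>d\<close> in the ideal, and the exchange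
  between bases is an exchange within the ideal.\<close>

lemma componentwise_polymatroidal_exchange:
  fixes A :: "('n::finite \<Rightarrow>\<^sub>0 nat) set"
  assumes "componentwise_polymatroidal (ideal_gen (monom ` A) :: ('n, 'k::field) mpoly set)"
  shows "exchange_on X (multiples A)"
  unfolding exchange_on_def
proof (intro allI impI, elim conjE)
  fix u v i
  assume u: "u \<in> multiples A" and v: "v \<in> multiples A" and deg: "vdeg u = vdeg v"
    and i: "lookup v i < lookup u i"
  let ?I = "ideal_gen (monom ` A) :: ('n, 'k) mpoly set"
  define B where "B = {a \<in> multiples A. vdeg a = vdeg v}"
  have comp: "ideal_component ?I (vdeg v) = ideal_gen (monom ` B)"
    unfolding ideal_component_def B_def
    by (rule arg_cong[of _ _ ideal_gen]) (auto simp: monom_mem_ideal_gen)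
  have "v \<in> B" "u \<in> B" using u v deg by (simp_all add: B_def)
  then have "(monom v :: ('n, 'k) mpoly) \<in> ideal_component ?I (vdeg v)"
    using subset_multiples by (auto simp: comp monom_mem_ideal_gen)
  moreover have "(monom v :: ('n, 'k) mpoly) \<noteq> 0"
    by (metis keys_monom keys_zero insert_not_empty)
  ultimately have "polymatroidal (ideal_component ?I (vdeg v))"
    using assms unfolding componentwise_polymatroidal_def by blast
  then obtain P where P: "discrete_polymatroid P"
    and gens: "{a. (monom a :: ('n, 'k) mpoly) \<in> min_monom_gens (ideal_component ?I (vdeg v))}
      = bases P"
    unfolding polymatroidal_def by blast
  have "min_elems B = B" by (rule min_elems_homogeneous[of _ "vdeg v"]) (simp add: B_def)
  then have "bases P = B"
    using gens by (simp add: comp min_monom_gens_ideal_gen inj_image_mem_iff[OF inj_monom])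
  then show "\<exists>j w. lookup u j < lookup v j \<and> w \<in> multiples A
      \<and> w + unit_vec j = v + unit_vec i"
    using bases_dual_exchange[OF P _ _ deg i] \<open>u \<in> B\<close> \<open>v \<in> B\<close> by (auto simp: B_def)
qed

section \<open>Componentwise polymatroidal ideals have linear quotients\<close>

theorem theorem3p1:
  fixes I :: "('n::finite, 'k::field) mpoly set"
  assumes "monomial_ideal I"
    and "componentwise_polymatroidal I"
  shows "linear_quotients I"
proof -
  obtain A where I: "I = ideal_gen (monom ` A)"
    using assms(1) by (auto simp: monomial_ideal_def)
  have "exchange_on UNIV (multiples (min_elems A))"
    using assms(2) componentwise_polymatroidal_exchange unfolding I multiples_min_elems by blast
  then obtain gs where "distinct gs" "set gs = min_elems A" "linear_quotient_order gs"
    using linear_quotient_order_exists[of "min_elems A" UNIV] vantichain_min_elems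
      finite_vantichain[OF vantichain_min_elems] by blast
  then show ?thesis unfolding I by (rule linear_quotients_if_order)
qed

end
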